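(* For every integer $m\ge 0$ the following identities hold in the algebra of dual quaternions: (i) $$2JN_{m}^{(3)}+JN_{m+1}^{(3)}+JN_{m+2}^{(3)}=JN_{m+3}^{(3)};$$ (ii) $$JN_{m}^{(3)}-JN_{m+1}^{(3)}\mathbf{i}-JN_{m+2}^{(3)}\mathbf{j}-JN_{m+3}^{(3)}\mathbf{k}=J_{m}^{(3)};$$ (iii) $$\left(JN_{m}^{(3)}\right)^{2}+\left(JN_{m+1}^{(3)}\right)^{2}+\left(JN_{m+2}^{(3)}\right)^{2}=\frac{1}{7}\Big(3\cdot 2^{2(m+1)}(1+4\mathbf{i}+8\mathbf{j}+16\mathbf{k})-2^{m+2}UN_{m}^{(3)}-2^{m+3}U_{m}^{(3)}(\mathbf{i}+2\mathbf{j}+4\mathbf{k})+2(1-\mathbf{i}-\mathbf{j}+2\mathbf{k})\Big).$$ Here $U_{m}^{(3)}=\frac{1}{7}\left(V_{m+1}^{(3)}+3V_{m+2}^{(3)}\right)$ and $UN_{m}^{(3)}=U_{m}^{(3)}+U_{m+1}^{(3)}\mathbf{i}+U_{m+2}^{(3)}\mathbf{j}+U_{m+3}^{(3)}\mathbf{k}$.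
   Context: Dual quaternions: the real algebra of elements $a+b\mathbf{i}+c\mathbf{j}+d\mathbf{k}$ ($a,b,c,d\in\mathbb{R}$) with componentwise addition and bilinear multiplication determined by $1$ being the identity and $\mathbf{i}^2=\mathbf{j}^2=\mathbf{k}^2=0$, $\mathbf{ij}=\mathbf{ji}=\mathbf{jk}=\mathbf{kj}=\mathbf{ik}=\mathbf{ki}=0$ (all products of two units among $\mathbf{i},\mathbf{j},\mathbf{k}$ vanish). Real numbers are identified with the elements having $b=c=d=0$. The third-order Jacobsthal numbers are defined by $J_0^{(3)}=0$, $J_1^{(3)}=J_2^{(3)}=1$, $J_{n+3}^{(3)}=J_{n+2}^{(3)}+J_{n+1}^{(3)}+2J_n^{(3)}$ for $n\ge 0$. The superscript $(3)$ is part of the notation, not an exponent. The dual third-order Jacobsthal quaternions are $JN_m^{(3)}=J_m^{(3)}+J_{m+1}^{(3)}\mathbf{i}+J_{m+2}^{(3)}\mathbf{j}+J_{m+3}^{(3)}\mathbf{k}$ for $m\ge 0$. The sequence $V_n^{(3)}$ ($n\ge 0$) is given by $V_n^{(3)}=2$ if $n\equiv 0 \pmod 3$, $V_n^{(3)}=-3$ if $n\equiv 1\pmod 3$, $V_n^{(3)}=1$ if $n\equiv 2\pmod 3$. *)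

theory Defs
  imports Complex_Main
begin

datatype dual_quat = DQuat (DQ1: real) (DQi: real) (DQj: real) (DQk: real)

lemma dual_quat_eq_iff:
  "x = y \<longleftrightarrow> DQ1 x = DQ1 y \<and> DQi x = DQi y \<and> DQj x = DQj y \<and> DQk x = DQk y"
  by (cases x; cases y) simp

instantiation dual_quat :: "{real_algebra_1, comm_ring_1}"
begin

definition "0 = DQuat 0 0 0 0"
definition "1 = DQuat 1 0 0 0"
definition "x + y = DQuat (DQ1 x + DQ1 y) (DQi x + DQi y) (DQj x + DQj y) (DQk x + DQk y)"
definition "- x = DQuat (- DQ1 x) (- DQi x) (- DQj x) (- DQk x)"
definition "x - y = DQuat (DQ1 x - DQ1 y) (DQi x - DQi y) (DQj x - DQj y) (DQk x - DQk y)"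
definition "r *\<^sub>R x = DQuat (r * DQ1 x) (r * DQi x) (r * DQj x) (r * DQk x)"

(* The bilinear product in which all products of two units among i, j, k vanish,
   written in components; see the lemma dq_units_mult below. *)
definition
  "x * y = DQuat (DQ1 x * DQ1 y) (DQ1 x * DQi y + DQi x * DQ1 y)
                 (DQ1 x * DQj y + DQj x * DQ1 y) (DQ1 x * DQk y + DQk x * DQ1 y)"

instance
  by standard
    (simp_all add: dual_quat_eq_iff zero_dual_quat_def one_dual_quat_def plus_dual_quat_def
      uminus_dual_quat_def minus_dual_quat_def scaleR_dual_quat_def times_dual_quat_def
      algebra_simps)

end

definition dq_i :: dual_quat where "dq_i = DQuat 0 1 0 0"
definition dq_j :: dual_quat where "dq_j = DQuat 0 0 1 0"
definition dq_k :: dual_quat where "dq_k = DQuat 0 0 0 1"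

lemma dq_units_mult:
  "x \<in> {dq_i, dq_j, dq_k} \<Longrightarrow> y \<in> {dq_i, dq_j, dq_k} \<Longrightarrow> x * y = 0"
  by (auto simp: dq_i_def dq_j_def dq_k_def times_dual_quat_def zero_dual_quat_def)

lemma DQuat_eq: "DQuat a b c d = of_real a + b *\<^sub>R dq_i + c *\<^sub>R dq_j + d *\<^sub>R dq_k"
  by (simp add: of_real_def dual_quat_eq_iff one_dual_quat_def plus_dual_quat_def
      scaleR_dual_quat_def dq_i_def dq_j_def dq_k_def)

fun J3 :: "nat \<Rightarrow> nat" where
  "J3 0 = 0"
| "J3 (Suc 0) = 1"
| "J3 (Suc (Suc 0)) = 1"
| "J3 (Suc (Suc (Suc n))) = J3 (Suc (Suc n)) + J3 (Suc n) + 2 * J3 n"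

definition JN3 :: "nat \<Rightarrow> dual_quat" where
  "JN3 m = of_real (J3 m) + real (J3 (m + 1)) *\<^sub>R dq_i
           + real (J3 (m + 2)) *\<^sub>R dq_j + real (J3 (m + 3)) *\<^sub>R dq_k"

definition V3 :: "nat \<Rightarrow> real" where
  "V3 n = (if n mod 3 = 0 then 2 else if n mod 3 = 1 then - 3 else 1)"

definition U3 :: "nat \<Rightarrow> real" where
  "U3 m = (1 / 7) * (V3 (m + 1) + 3 * V3 (m + 2))"

definition UN3 :: "nat \<Rightarrow> dual_quat" where
  "UN3 m = of_real (U3 m) + U3 (m + 1) *\<^sub>R dq_i + U3 (m + 2) *\<^sub>R dq_j + U3 (m + 3) *\<^sub>R dq_k"

end

(* By the Binet-type formula 7 J_m = 2^(m+1) - V_m with V of period 3, both sides of (iii)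
   are, component by component and for each residue of m modulo 3, the same quadratic
   polynomial in 2^m. Identities (i) and (ii) follow directly from the recurrence and from the
   vanishing of products of units. *)
theory Submission
  imports Defs
begin

lemma V3_period: "V3 (m + 3) = V3 m"
  by (simp add: V3_def)

text \<open>Three consecutive indices meet each residue modulo 3 once, and the values 2, -3, 1 add
  up to 0.\<close>

lemma V3_sum: "V3 (m + 2) = - V3 m - V3 (m + 1)"
  unfolding V3_def by (auto; presburger)

text \<open>The characteristic polynomial x^3 - x^2 - x - 2 factors as (x - 2)(x^2 + x + 1). Hence
  2^m and \<open>V3\<close>, which comes from the primitive cube roots of unity, both solve the
  recurrence, and the three initial values fix the combination.\<close>

lemma J3_Binet: "real (J3 m) = (2 * 2 ^ m - V3 m) / 7"
proof (induction m rule: J3.induct)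
  case (4 n)
  have "V3 (Suc (Suc (Suc n))) = V3 (Suc (Suc n)) + V3 (Suc n) + 2 * V3 n"
    using V3_sum[of n] V3_period[of n] by (simp add: numeral_eq_Suc)
  with 4 show ?case by (simp add: field_simps)
qed (simp_all add: V3_def)

lemmas dual_quat_components = dual_quat_eq_iff of_real_def zero_dual_quat_def
  one_dual_quat_def plus_dual_quat_def minus_dual_quat_def scaleR_dual_quat_def
  times_dual_quat_def dq_i_def dq_j_def dq_k_def

lemma JN3_eq_DQuat: "JN3 m = DQuat (J3 m) (J3 (m + 1)) (J3 (m + 2)) (J3 (m + 3))"
  by (simp add: JN3_def DQuat_eq)

lemma UN3_eq_DQuat: "UN3 m = DQuat (U3 m) (U3 (m + 1)) (U3 (m + 2)) (U3 (m + 3))"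
  by (simp add: UN3_def DQuat_eq)

lemma J3_rec: "J3 (m + 3) = J3 (m + 2) + J3 (m + 1) + 2 * J3 m"
  by (simp add: numeral_eq_Suc)

lemma JN3_rec: "(2::real) *\<^sub>R JN3 m + JN3 (m + 1) + JN3 (m + 2) = JN3 (m + 3)"
  \<comment> \<open>One shifted instance of the recurrence for each of the four components.\<close>
  using J3_rec[of m] J3_rec[of "m + 1"] J3_rec[of "m + 2"] J3_rec[of "m + 3"]
  by (simp add: JN3_eq_DQuat dual_quat_components)

text \<open>Multiplying by a unit keeps only the real part of the other factor, so each product is
  exactly the matching unit term of \<open>JN3 m\<close>.\<close>

lemma JN3_diff_units:
  "JN3 m - JN3 (m + 1) * dq_i - JN3 (m + 2) * dq_j - JN3 (m + 3) * dq_k = of_real (J3 m)"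
  by (simp add: JN3_eq_DQuat dual_quat_components)

lemma JN3_sum_squares:
  "(JN3 m)^2 + (JN3 (m + 1))^2 + (JN3 (m + 2))^2 =
      (1 / 7 :: real) *\<^sub>R
        ((3 * 2 ^ (2 * (m + 1)) :: real) *\<^sub>R
            (1 + (4::real) *\<^sub>R dq_i + (8::real) *\<^sub>R dq_j + (16::real) *\<^sub>R dq_k)
         - (2 ^ (m + 2) :: real) *\<^sub>R UN3 m
         - (2 ^ (m + 3) * U3 m) *\<^sub>R (dq_i + (2::real) *\<^sub>R dq_j + (4::real) *\<^sub>R dq_k)
         + (2::real) *\<^sub>R (1 - dq_i - dq_j + (2::real) *\<^sub>R dq_k))"
proof -
  \<comment> \<open>By periodicity and \<open>V3_sum\<close>, these three numbers determine all
    entries that occur, up to index \<open>m + 5\<close>.\<close>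
  define p v w where "p = (2::real) ^ m" and "v = V3 m" and "w = V3 (m + 1)"
  have shifts: "m + 1 + 1 = m + 2" "m + 1 + 2 = m + 3" "m + 1 + 3 = m + 4" "m + 2 + 1 = m + 3"
      "m + 2 + 2 = m + 4" "m + 2 + 3 = m + 5" "m + 3 + 1 = m + 4" "m + 3 + 2 = m + 5"
    by simp_all
  have V: "V3 (m + 2) = - v - w" "V3 (m + 3) = v" "V3 (m + 4) = w" "V3 (m + 5) = - v - w"
    using V3_sum[of m] V3_period[of m] V3_period[of "m + 1"] V3_period[of "m + 2"]
    by (simp_all add: v_def w_def ac_simps)
  have J: "real (J3 m) = (2 * p - v) / 7" "real (J3 (m + 1)) = (4 * p - w) / 7"
      "real (J3 (m + 2)) = (8 * p + v + w) / 7" "real (J3 (m + 3)) = (16 * p - v) / 7"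
      "real (J3 (m + 4)) = (32 * p - w) / 7" "real (J3 (m + 5)) = (64 * p + v + w) / 7"
    by (simp_all only: J3_Binet V flip: v_def w_def) (simp_all add: p_def power_add)
  have U: "U3 m = (- 3 * v - 2 * w) / 7" "U3 (m + 1) = (2 * v - w) / 7"
      "U3 (m + 2) = (v + 3 * w) / 7" "U3 (m + 3) = (- 3 * v - 2 * w) / 7"
    by (simp_all only: U3_def shifts V flip: w_def) (simp_all add: field_simps)
  have JN: "JN3 m = DQuat ((2 * p - v) / 7) ((4 * p - w) / 7) ((8 * p + v + w) / 7) ((16 * p - v) / 7)"
      "JN3 (m + 1) = DQuat ((4 * p - w) / 7) ((8 * p + v + w) / 7) ((16 * p - v) / 7) ((32 * p - w) / 7)"
      "JN3 (m + 2) = DQuat ((8 * p + v + w) / 7) ((16 * p - v) / 7) ((32 * p - w) / 7) ((64 * p + v + w) / 7)"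
    by (simp_all only: JN3_eq_DQuat shifts J)
  have P: "(2::real) ^ (2 * (m + 1)) = 4 * (p * p)" "(2::real) ^ (m + 2) = 4 * p"
      "(2::real) ^ (m + 3) = 8 * p"
    by (simp_all add: p_def power_add power_mult_distrib power2_eq_square power_even_eq)
  \<comment> \<open>For arbitrary v and w the two sides agree only in the terms containing p. The
    terms free of p also need v^2 + v w + w^2 = 7, which holds for these three pairs; this is the
    source of the summand 2(1 - i - j + 2k).\<close>
  have "(v, w) \<in> {(2, - 3), (- 3, 1), (1, 2)}"
    unfolding v_def w_def V3_def by (auto; presburger)
  then show ?thesis
    unfolding JN UN3_eq_DQuat U P
    by (auto simp: dual_quat_components power2_eq_square field_simps)
qed

theorem theorem2p1:
  fixes m :: nat
  shows "(2::real) *\<^sub>R JN3 m + JN3 (m + 1) + JN3 (m + 2) = JN3 (m + 3)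
    \<and> JN3 m - JN3 (m + 1) * dq_i - JN3 (m + 2) * dq_j - JN3 (m + 3) * dq_k = of_real (J3 m)
    \<and> (JN3 m)^2 + (JN3 (m + 1))^2 + (JN3 (m + 2))^2 =
      (1 / 7 :: real) *\<^sub>R
        ((3 * 2 ^ (2 * (m + 1)) :: real) *\<^sub>R
            (1 + (4::real) *\<^sub>R dq_i + (8::real) *\<^sub>R dq_j + (16::real) *\<^sub>R dq_k)
         - (2 ^ (m + 2) :: real) *\<^sub>R UN3 m
         - (2 ^ (m + 3) * U3 m) *\<^sub>R (dq_i + (2::real) *\<^sub>R dq_j + (4::real) *\<^sub>R dq_k)
         + (2::real) *\<^sub>R (1 - dq_i - dq_j + (2::real) *\<^sub>R dq_k))"
  using JN3_rec JN3_diff_units JN3_sum_squares by blast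

end
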